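(* Let $-1\le B<A\le 1$. Let $c,\lambda,b\in\mathbb{C}$ and $\kappa=\lambda+\frac{b+1}{2}$ with $\kappa\ne 0,-1,-2,-3,\dots$. Suppose that the one of the following conditions corresponding to the values of $A,B$ holds: (i) if $-1=B<A\le 3-2\sqrt2$: $$\operatorname{Re}(\kappa-1)\ge \frac{|c|}{4(1+A)}\left(\sqrt{2(1+A^2)}+(1-A)\right);$$ (ii) if $B=-1$ and $A>3-2\sqrt2$: $$\operatorname{Re}(\kappa-1)\ge\frac{|c|(1+A)}{8\sqrt A}\quad\text{and}\quad \operatorname{Re}(\kappa-1)\le \frac{|c|(1+A)}{2(1-A)}$$ (when $A=1$ the second inequality is read as no condition); (iii) if $-1<B<0$: $$\operatorname{Re}(\kappa-1)\ge\frac{|c|(1+A)(1-B)^2}{4(A-B)(1+B)}-\frac{1+B}{1-B};$$ (iv) if $B\ge 0$: $$\operatorname{Re}(\kappa-1)\ge\frac{|c|(1+A)(1+B)}{4(A-B)}-\frac{1-B}{1+B}.$$ If $(1+B)u_\lambda(z)\ne 1+A$ for all $z\in\mathbb{D}$, then $u_\lambda\in\mathcal{P}[A,B]$.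
   Context: $\mathbb{D}=\{z\in\mathbb{C}:|z|<1\}$. For $b,\lambda,c\in\mathbb{C}$ with $\kappa=\lambda+\frac{b+1}{2}\ne 0,-1,-2,\dots$, the normalized generalized Bessel function $u_\lambda=u_{\lambda,b,c}$ is the entire function $$u_\lambda(z)=\sum_{k=0}^\infty\frac{(-1)^kc^k}{4^k(\kappa)_k}\frac{z^k}{k!},$$ where $(\kappa)_k=\kappa(\kappa+1)\cdots(\kappa+k-1)$, $(\kappa)_0=1$. For $f,g$ analytic in $\mathbb{D}$, $f\prec g$ ($f$ is subordinate to $g$) means that there is an analytic $w:\mathbb{D}\to\mathbb{D}$ with $w(0)=0$ and $f=g\circ w$. For $-1\le B<A\le1$, $\mathcal{P}[A,B]$ is the family of functions $p$ analytic in $\mathbb{D}$ with $p(0)=1$ and $p(z)\prec\frac{1+Az}{1+Bz}$. *)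

theory Defs
  imports "HOL-Complex_Analysis.Complex_Analysis"
begin

text \<open>
  The power series has infinite radius of convergence. If \<open>lam + (b + 1) / 2\<close> is
  a non-positive integer, then some coefficients involve a division by zero and the value
  is meaningless; this is excluded wherever the function is used.
\<close>

definition gen_bessel :: "complex \<Rightarrow> complex \<Rightarrow> complex \<Rightarrow> complex \<Rightarrow> complex" where
  "gen_bessel lam b c z =
     (\<Sum>k. ((-1) ^ k * c ^ k) / (4 ^ k * pochhammer (lam + (b + 1) / 2) k) * (z ^ k / fact k))"

definition subordinate :: "(complex \<Rightarrow> complex) \<Rightarrow> (complex \<Rightarrow> complex) \<Rightarrow> bool" where
  "subordinate f g \<longleftrightarrow>
     (\<exists>w. w analytic_on ball 0 1 \<and> w ` ball 0 1 \<subseteq> ball 0 1 \<and> w 0 = 0 \<and>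
          (\<forall>z\<in>ball 0 1. f z = g (w z)))"

text \<open>
  Functions are total on \<^typ>\<open>complex\<close>; only their values on the open unit disc matter for
  membership in the following family.
\<close>

definition janowski :: "real \<Rightarrow> real \<Rightarrow> (complex \<Rightarrow> complex) set" where
  "janowski A B =
     {p. p analytic_on ball 0 1 \<and> p 0 = 1 \<and>
         subordinate p (\<lambda>z. (1 + of_real A * z) / (1 + of_real B * z))}"

end

theory Submission
  imports Defs
begin

text \<open>
  The map \<open>w \<mapsto> (1 + A w) / (1 + B w)\<close> is, after the Cayley transform \<open>w = (p - 1) / (p + 1)\<close>,
  the Moebius map \<open>p \<mapsto> ((1 - A) + (1 + A) p) / ((1 - B) + (1 + B) p)\<close>, and the unit disc becomes
  the right half-plane. Writing \<open>u = gen_bessel lam b c\<close> as the image of a function \<open>p\<close> under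
  this map, one has \<open>p 0 = 1\<close>, the hypothesis \<open>(1 + B) u \<noteq> 1 + A\<close> says exactly that \<open>p\<close> has no
  pole, and the claim becomes that \<open>p\<close> has positive real part (\<open>janowski_if_Re_pos\<close>).

  Positivity is a maximum-principle argument. The series gives the equation
  \<open>z u'' + \<kappa> u' + (c / 4) u = 0\<close> (\<open>gen_bessel_ode\<close>), which the substitution turns into a nonlinear
  equation for \<open>p\<close> (\<open>Moebius_transform_ode\<close>). If \<open>Re p\<close> is not positive on the disc, it vanishes
  at some first point \<open>z\<close>, meaning one of least modulus. There \<open>p z = \<i> \<rho>\<close>, the number \<open>z p'\<close> is a
  real \<open>\<sigma> \<le> - (1 + \<rho>\<^sup>2) / 2\<close>, and \<open>Re (z\<^sup>2 p'') \<le> - \<sigma>\<close> (\<open>Miller_Mocanu_boundary_point\<close>).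

  In the real part of the equation at \<open>z\<close>, all terms without \<open>c\<close> together then contribute at most
  \<open>- (1 + \<rho>\<^sup>2) / 2\<close> times
  \<open>Re (\<kappa> - 1) + (1 - B\<^sup>2) (1 + \<rho>\<^sup>2) / ((1 - B)\<^sup>2 + (1 + B)\<^sup>2 \<rho>\<^sup>2)\<close>, provided this factor is
  nonnegative. The term with \<open>c\<close> is bounded by \<open>norm z < 1\<close> times an explicit multiple of \<open>norm c\<close>. The
  four lower bounds on \<open>Re (\<kappa> - 1)\<close> are what makes the first contribution dominate for every
  real \<open>\<rho>\<close> (\<open>bessel_estimate\<close>), so the real part is negative and cannot vanish.
\<close>

section \<open>First boundary points of functions into the right half-plane\<close>

lemma Cayley_transform_in_disc:
  fixes v :: complex
  assumes "0 < Re v"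
  shows "v + 1 \<noteq> 0" and "norm ((v - 1) / (v + 1)) < 1"
proof -
  show ne: "v + 1 \<noteq> 0" using assms by (auto simp: complex_eq_iff)
  have "(norm (v - 1))\<^sup>2 < (norm (v + 1))\<^sup>2"
    using assms unfolding cmod_power2 by (simp add: power2_eq_square algebra_simps)
  then have "norm (v - 1) < norm (v + 1)" by (rule power_less_imp_less_base) simp
  then show "norm ((v - 1) / (v + 1)) < 1" using ne by (simp add: norm_divide)
qed

lemma second_derivative_nonneg_at_min:
  fixes f f' :: "real \<Rightarrow> real"
  assumes f: "\<And>t. (f has_real_derivative f' t) (at t)"
    and f': "(f' has_real_derivative l) (at a)"
    and min: "\<And>t. f a \<le> f t"
  shows "f' a = 0" "0 \<le> l"
proof -
  show f'a: "f' a = 0" using DERIV_local_min[OF f, of 1 a] min by simp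
  show "0 \<le> l"
  proof (rule ccontr)
    assume "\<not> 0 \<le> l"
    then obtain d where d: "d > 0" "\<And>h. 0 < h \<Longrightarrow> h < d \<Longrightarrow> f' (a + h) < 0"
      using DERIV_neg_dec_right[OF f'] f'a by auto
    have "f a > f (a + d / 2)"
    proof (rule DERIV_neg_imp_decreasing_open[of a "a + d / 2" f])
      show "a < a + d / 2" using d by simp
      show "\<exists>y. (f has_real_derivative y) (at x) \<and> y < 0" if "a < x" "x < a + d / 2" for x
        using f[of x] d(2)[of "x - a"] that d(1) by auto
      show "continuous_on {a..a + d / 2} f"
        using f by (meson DERIV_atLeastAtMost_imp_continuous_on)
    qed
    then show False using min[of "a + d / 2"] by simp
  qed
qed

text \<open>
  The point sought minimises the modulus over the compact set where \<open>Re p \<le> 0\<close> inside a smaller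
  closed disc. Every point on its circle is a radial limit of points with \<open>Re p > 0\<close>.
\<close>
lemma first_boundary_point:
  assumes hol: "p holomorphic_on ball 0 1" and p0: "p 0 = 1"
    and neg: "\<exists>z\<in>ball 0 1. Re (p z) \<le> 0"
  obtains z where "0 < norm z" "norm z < 1" "Re (p z) = 0"
    and "\<And>y. norm y < norm z \<Longrightarrow> 0 < Re (p y)"
    and "\<And>y. norm y = norm z \<Longrightarrow> 0 \<le> Re (p y)"
proof -
  obtain z1 where z1: "norm z1 < 1" "Re (p z1) \<le> 0" using neg by auto
  define S where "S = {z \<in> cball 0 (norm z1). Re (p z) \<le> 0}"
  have sub: "cball 0 (norm z1) \<subseteq> ball (0::complex) 1" using z1 by auto
  have cont: "continuous_on (cball 0 (norm z1)) (\<lambda>z. Re (p z))"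
    using holomorphic_on_imp_continuous_on[OF holomorphic_on_subset[OF hol sub]]
    by (intro continuous_intros)
  have "closed S" unfolding S_def
    using continuous_closed_preimage[OF cont, of "{..0}"] by (simp add: Int_def vimage_def)
  moreover have "bounded S" by (rule bounded_subset[of "cball 0 (norm z1)"]) (auto simp: S_def)
  ultimately have "compact S" by (simp add: compact_eq_bounded_closed)
  moreover have "z1 \<in> S" using z1 by (auto simp: S_def)
  ultimately obtain z where z: "z \<in> S" and min: "\<And>y. y \<in> S \<Longrightarrow> norm z \<le> norm y"
    using continuous_attains_inf[of S norm] continuous_on_norm_id by blast
  have zs: "norm z \<le> norm z1" "Re (p z) \<le> 0" using z by (auto simp: S_def)
  have z0: "z \<noteq> 0" using zs p0 by auto
  have pos: "0 < Re (p y)" if "norm y < norm z" for y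
    using min[of y] that zs by (force simp: S_def)
  have pos_le: "0 \<le> Re (p y)" if "norm y = norm z" for y
  proof (rule tendsto_lowerbound)
    have "isCont p (of_real 1 * y)"
      using hol that zs z1 by (simp add: continuous_on_interior[of "ball 0 1"]
          holomorphic_on_imp_continuous_on)
    then have "((\<lambda>t. Re (p (of_real t * y))) \<longlongrightarrow> Re (p (of_real 1 * y))) (at_left 1)"
      by (intro tendsto_intros isCont_tendsto_compose[where g = p])
    then show "((\<lambda>t. Re (p (of_real t * y))) \<longlongrightarrow> Re (p y)) (at_left 1)" by simp
    have "\<forall>\<^sub>F t in at_left 1. t \<in> {0<..<(1::real)}" by (rule eventually_at_leftI[of 0]) auto
    then show "\<forall>\<^sub>F t in at_left 1. 0 \<le> Re (p (of_real t * y))"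
      by eventually_elim (use z0 that in \<open>auto intro!: less_imp_le pos simp: norm_mult\<close>)
  qed simp
  have "Re (p z) = 0" using pos_le[of z] zs by simp
  then show thesis using that[of z] z0 zs z1 pos pos_le by auto
qed

text \<open>
  All conditions come from two one-dimensional extremum problems at the first boundary point \<open>z\<close>.
  Along its circle, \<open>Re p\<close> is minimal at \<open>z\<close>: the first derivative in the angle makes \<open>z p'\<close>
  real, the second one gives the inequality for \<open>p''\<close>. Along its radius, Schwarz's lemma for the
  Cayley transform of \<open>p\<close> bounds \<open>norm ((p - 1) / (p + 1))\<close> by \<open>t\<close> at \<open>t z\<close>, with equality at
  \<open>t = 1\<close>; comparing derivatives there gives the upper bound for \<open>z p'\<close>.
\<close>
lemma Miller_Mocanu_boundary_point:
  assumes hol: "p holomorphic_on ball 0 1" and p0: "p 0 = 1"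
    and neg: "\<exists>z\<in>ball 0 1. Re (p z) \<le> 0"
  obtains z where "norm z < 1" "Re (p z) = 0" "Im (z * deriv p z) = 0"
    and "Re (z * deriv p z) \<le> - (1 + (Im (p z))\<^sup>2) / 2"
    and "Re (z * deriv p z) + Re (z\<^sup>2 * deriv (deriv p) z) \<le> 0"
proof -
  obtain z where z: "0 < norm z" "norm z < 1" "Re (p z) = 0"
    and pos: "\<And>y. norm y < norm z \<Longrightarrow> 0 < Re (p y)"
    and pos_le: "\<And>y. norm y = norm z \<Longrightarrow> 0 \<le> Re (p y)"
    using first_boundary_point[OF assms] by blast
  have hol': "deriv p holomorphic_on ball 0 1" using hol by (simp add: holomorphic_deriv)
  have dp: "(p has_field_derivative deriv p y) (at y)" if "norm y < 1" for y
    using hol that by (simp add: holomorphic_derivI[of p "ball 0 1"])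
  have dp': "(deriv p has_field_derivative deriv (deriv p) y) (at y)" if "norm y < 1" for y
    using hol' that by (simp add: holomorphic_derivI[of _ "ball 0 1"])
  define e where "e t = z * exp (\<i> * of_real t)" for t :: real
  have norm_e: "norm (e t) = norm z" for t by (simp add: e_def norm_mult)
  have e0: "e 0 = z" by (simp add: e_def)
  have de: "(e has_vector_derivative (\<i> * e t)) (at t)" for t
  proof -
    have "((\<lambda>s. z * exp (\<i> * s)) has_field_derivative (\<i> * e t)) (at (of_real t))"
      by (auto intro!: derivative_eq_intros simp: e_def)
    from has_vector_derivative_real_field[OF this] show ?thesis unfolding e_def .
  qed
  have d1: "((\<lambda>t. Re (p (e t))) has_real_derivative Re (\<i> * e t * deriv p (e t))) (at t)" for t
    using has_field_derivative_Re[OF field_vector_diff_chain_at[OF de dp, of t]] norm_e z(2)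
    by (simp add: o_def)
  have d2: "((\<lambda>t. Re (\<i> * e t * deriv p (e t))) has_real_derivative
      Re (\<i> * e 0 * (\<i> * e 0 * deriv (deriv p) (e 0)) + \<i> * (\<i> * e 0) * deriv p (e 0))) (at 0)"
    using field_vector_diff_chain_at[OF de dp', of 0] norm_e[of 0] z(2)
    by (intro has_field_derivative_Re has_vector_derivative_mult
        has_vector_derivative_mult_right de) (auto simp: o_def)
  have min: "Re (p (e 0)) \<le> Re (p (e t))" for t
    using pos_le[OF norm_e, of t] z(3) by (simp add: e0)
  note second = second_derivative_nonneg_at_min[OF d1 d2 min]
  have im: "Im (z * deriv p z) = 0" using second(1) by (simp add: e0 mult.assoc)
  have snd: "Re (z * deriv p z) + Re (z\<^sup>2 * deriv (deriv p) z) \<le> 0"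
  proof -
    have "\<i> * z * (\<i> * z * deriv (deriv p) z) + \<i> * (\<i> * z) * deriv p z
        = - (z * deriv p z + z\<^sup>2 * deriv (deriv p) z)"
      by (simp add: power2_eq_square algebra_simps)
    then show ?thesis using second(2) unfolding e0 by simp
  qed

  \<comment> \<open>Rescaling the disc of radius \<open>norm z\<close> to the unit disc brings Schwarz's lemma into play.\<close>
  define w where "w y = (p (of_real (norm z) * y) - 1) / (p (of_real (norm z) * y) + 1)" for y
  have w: "norm (w y) \<le> norm y" if "norm y < 1" for y
  proof -
    have posy: "0 < Re (p (of_real (norm z) * v))" if "norm v < 1" for v :: complex
      using pos[of "of_real (norm z) * v"] that z by (simp add: norm_mult)
    have le: "norm (of_real (norm z) * v) < 1" if "norm v < 1" for v :: complex
      using that z mult_strict_mono[of "norm z" 1 "norm v" 1] by (simp add: norm_mult)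
    note Cayley = Cayley_transform_in_disc[OF posy]
    show ?thesis
    proof (rule Schwarz_Lemma(1)[OF _ _ _ that])
      show "w holomorphic_on ball 0 1" unfolding w_def
        using le Cayley(1)
        by (intro holomorphic_intros holomorphic_on_compose_gen[OF _ hol, unfolded o_def]) auto
      show "w 0 = 0" by (simp add: w_def p0)
      show "norm (w v) < 1" if "norm v < 1" for v :: complex
        using Cayley(2)[OF that] by (simp add: w_def)
    qed
  qed
  \<comment> \<open>This is \<open>t\<^sup>2 (norm (p + 1))\<^sup>2 - (norm (p - 1))\<^sup>2\<close> at \<open>t z\<close>: Schwarz's inequality cleared of
    denominators, so that only \<open>p\<close> itself has to be differentiated.\<close>
  define g where "g t = t\<^sup>2 * ((Re (p (of_real t * z)) + 1)\<^sup>2 + (Im (p (of_real t * z)))\<^sup>2)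
      - ((Re (p (of_real t * z)) - 1)\<^sup>2 + (Im (p (of_real t * z)))\<^sup>2)" for t
  have g: "0 \<le> g t" if "0 < t" "t < 1" for t
  proof -
    have tz: "of_real (norm z) * (of_real t * sgn z) = of_real t * z"
      using z(1) by (simp add: sgn_eq)
    have nt: "norm (of_real t * sgn z) = t" using that z(1) by (simp add: norm_mult norm_sgn)
    have "0 < Re (p (of_real t * z))" using pos[of "of_real t * z"] that z(1) by (simp add: norm_mult)
    then have "p (of_real t * z) + 1 \<noteq> 0" by (rule Cayley_transform_in_disc)
    then have "norm (p (of_real t * z) - 1) \<le> t * norm (p (of_real t * z) + 1)"
      using w[of "of_real t * sgn z"] that(2) unfolding w_def tz nt
      by (simp add: norm_divide pos_divide_le_eq)
    then have "(norm (p (of_real t * z) - 1))\<^sup>2 \<le> (t * norm (p (of_real t * z) + 1))\<^sup>2"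
      by (rule power_mono) simp
    then show ?thesis by (simp add: g_def cmod_power2 power_mult_distrib)
  qed
  have dr: "((\<lambda>t. p (of_real t * z)) has_vector_derivative (z * deriv p z)) (at 1)"
  proof -
    have "((\<lambda>s. p (s * z)) has_field_derivative (deriv p z * z)) (at (of_real 1))"
      by (rule DERIV_chain2[where f = p]) (use dp[OF z(2)] in \<open>auto intro!: derivative_eq_intros\<close>)
    from has_vector_derivative_real_field[OF this] show ?thesis by (simp add: mult.commute)
  qed
  have "(g has_real_derivative
      2 * (1 + (Im (p z))\<^sup>2) + 4 * Re (z * deriv p z)) (at 1)"
    unfolding g_def
    by (rule derivative_eq_intros dr refl | use z(3) im in simp)+
  then have "2 * (1 + (Im (p z))\<^sup>2) + 4 * Re (z * deriv p z) \<le> 0"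
  proof (rule contrapos_pp)
    assume "\<not> 2 * (1 + (Im (p z))\<^sup>2) + 4 * Re (z * deriv p z) \<le> 0"
    then have pos': "0 < 2 * (1 + (Im (p z))\<^sup>2) + 4 * Re (z * deriv p z)" by simp
    show "\<not> (g has_real_derivative
      2 * (1 + (Im (p z))\<^sup>2) + 4 * Re (z * deriv p z)) (at 1)"
    proof
      assume "(g has_real_derivative 2 * (1 + (Im (p z))\<^sup>2) + 4 * Re (z * deriv p z)) (at 1)"
      from DERIV_pos_inc_left[OF this pos'] obtain d
        where d: "d > 0" "\<And>h. 0 < h \<Longrightarrow> h < d \<Longrightarrow> g (1 - h) < g 1" by blast
      define h where "h = min (d / 2) (1 / 2)"
      have h: "0 < h" "h < d" "h < 1" using d(1) by (auto simp: h_def min_def)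
      have "g 1 = 0" using z(3) by (simp add: g_def)
      then show False using d(2)[of h] g[of "1 - h"] h by simp
    qed
  qed
  then show thesis using that[OF z(2,3) im _ snd] by simp
qed

section \<open>From the Janowski region to the right half-plane\<close>

text \<open>
  For \<open>\<alpha> \<noteq> \<beta>\<close>, the inverse of \<open>p \<mapsto> ((1 - \<alpha>) + (1 + \<alpha>) p) / ((1 - \<beta>) + (1 + \<beta>) p)\<close>. For \<open>\<alpha> = A\<close> and
  \<open>\<beta> = B\<close> it carries the image of the unit disc under \<open>w \<mapsto> (1 + A w) / (1 + B w)\<close> onto the right
  half-plane, and \<open>1\<close> to \<open>1\<close>.
\<close>
definition half_plane_transform :: "complex \<Rightarrow> complex \<Rightarrow> complex \<Rightarrow> complex" where
  "half_plane_transform \<alpha> \<beta> v = ((1 - \<beta>) * v - (1 - \<alpha>)) / ((1 + \<alpha>) - (1 + \<beta>) * v)"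

text \<open>
  The Cayley transform \<open>w = (p - 1) / (p + 1)\<close> is the Schwarz function that witnesses the
  subordination.
\<close>
lemma janowski_if_Re_pos:
  fixes A B :: real and u :: "complex \<Rightarrow> complex"
  defines "p \<equiv> (\<lambda>z. half_plane_transform (of_real A) (of_real B) (u z))"
  assumes AB: "B < A" and hol: "u holomorphic_on ball 0 1" and u0: "u 0 = 1"
    and ne: "\<forall>z\<in>ball 0 1. (1 + of_real B) * u z \<noteq> 1 + of_real A"
    and pos: "\<And>z. norm z < 1 \<Longrightarrow> 0 < Re (p z)"
  shows "u \<in> janowski A B"
proof -
  define w where "w z = (p z - 1) / (p z + 1)" for z
  have p1: "p z + 1 \<noteq> 0" if "norm z < 1" for z
    using pos[OF that] by (rule Cayley_transform_in_disc)
  have "p holomorphic_on ball 0 1"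
    unfolding p_def half_plane_transform_def using ne hol by (intro holomorphic_intros) force+
  then have w_hol: "w holomorphic_on ball 0 1"
    unfolding w_def using p1 by (intro holomorphic_intros) auto
  have w1: "norm (w z) < 1" if "norm z < 1" for z
    unfolding w_def using pos[OF that] by (rule Cayley_transform_in_disc)
  have AB': "complex_of_real A - of_real B \<noteq> 0" using AB by simp
  have "p 0 = 1" using AB' by (simp add: p_def half_plane_transform_def u0)
  then have w0: "w 0 = 0" by (simp add: w_def)
  have "u z = (1 + of_real A * w z) / (1 + of_real B * w z)" if z: "norm z < 1" for z
  proof -
    define E where "E = (1 + of_real A) - (1 + of_real B) * u z"
    have E: "E \<noteq> 0" using ne z by (force simp: E_def)
    have pE: "p z * E = (1 - of_real B) * u z - (1 - of_real A)"
      using E by (simp add: p_def half_plane_transform_def E_def)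
    have wp: "w z * (p z + 1) = p z - 1" using p1[OF z] by (simp add: w_def)
    \<comment> \<open>Both numerator (\<open>k = A\<close>) and denominator (\<open>k = B\<close>), freed of the two fractions in \<open>w\<close>.\<close>
    have lin: "(1 + of_real k * w z) * ((p z + 1) * E)
        = (1 + of_real k) * (p z * E) + (1 - of_real k) * E" for k
    proof -
      have "(1 + of_real k * w z) * ((p z + 1) * E)
          = (p z * E + E) + of_real k * (w z * (p z + 1)) * E" by (simp add: algebra_simps)
      then show ?thesis unfolding wp by (simp add: algebra_simps)
    qed
    have B: "(1 + of_real B * w z) * ((p z + 1) * E) = 2 * (of_real A - of_real B)"
      unfolding lin pE by (simp add: algebra_simps E_def)
    have A: "(1 + of_real A * w z) * ((p z + 1) * E) = u z * (2 * (of_real A - of_real B))"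
      unfolding lin pE by (simp add: algebra_simps E_def)
    have "1 + of_real B * w z \<noteq> 0" using B AB' by auto
    moreover have "u z * (1 + of_real B * w z) * ((p z + 1) * E)
        = (1 + of_real A * w z) * ((p z + 1) * E)"
      using A B by (simp only: mult.assoc)
    ultimately show ?thesis using p1[OF z] E by (simp add: eq_divide_eq)
  qed
  then have "subordinate u (\<lambda>z. (1 + of_real A * z) / (1 + of_real B * z))"
    unfolding subordinate_def using w_hol w1 w0
    by (intro exI[of _ w]) (auto simp: analytic_on_open)
  then show ?thesis using hol u0 by (simp add: janowski_def analytic_on_open)
qed

text \<open>
  With \<open>\<delta> = 2 (\<alpha> - \<beta>)\<close> the transform satisfies \<open>p' = u' D\<^sup>2 / \<delta>\<close>, and \<open>N = u D\<close>. The quadratic term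
  in \<open>p'\<close> is there to cancel the part of \<open>p''\<close> that comes from differentiating \<open>D\<^sup>2\<close>; what remains is
  \<open>z D\<^sup>2 / \<delta>\<close> times the linear equation for \<open>u\<close>.
\<close>
lemma Moebius_transform_ode:
  fixes \<alpha> \<beta> \<kappa> c :: complex and u :: "complex \<Rightarrow> complex"
  defines "p \<equiv> (\<lambda>z. half_plane_transform \<alpha> \<beta> (u z))"
  assumes S: "open S" "z \<in> S" and hol: "u holomorphic_on S" and ab: "\<alpha> \<noteq> \<beta>"
    and ode: "z * deriv (deriv u) z + \<kappa> * deriv u z + c / 4 * u z = 0"
    and ne: "\<And>y. y \<in> S \<Longrightarrow> (1 + \<beta>) * u y \<noteq> 1 + \<alpha>"
  defines "N \<equiv> (1 - \<alpha>) + (1 + \<alpha>) * p z" and "D \<equiv> (1 - \<beta>) + (1 + \<beta>) * p z"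
  shows "z\<^sup>2 * deriv (deriv p) z - 2 * (1 + \<beta>) * (z * deriv p z)\<^sup>2 / D
           + \<kappa> * (z * deriv p z) + c * z * (N * D) / (8 * (\<alpha> - \<beta>)) = 0"
proof -
  define \<delta> where "\<delta> = 2 * (\<alpha> - \<beta>)"
  define E where "E y = (1 + \<alpha>) - (1 + \<beta>) * u y" for y
  have E: "E y \<noteq> 0" if "y \<in> S" for y using ne[OF that] by (auto simp: E_def)
  have du: "(u has_field_derivative deriv u y) (at y)" if "y \<in> S" for y
    using hol S(1) that by (rule holomorphic_derivI)
  have du': "(deriv u has_field_derivative deriv (deriv u) y) (at y)" if "y \<in> S" for y
    using holomorphic_deriv[OF hol S(1)] S(1) that by (rule holomorphic_derivI)
  have dE: "(E has_field_derivative - (1 + \<beta>) * deriv u y) (at y)" if "y \<in> S" for y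
    unfolding E_def by (auto intro!: derivative_eq_intros du that simp: algebra_simps)
  have p': "deriv p y = \<delta> * deriv u y / (E y)\<^sup>2" if y: "y \<in> S" for y
  proof (rule DERIV_imp_deriv)
    have "((\<lambda>y. ((1 - \<beta>) * u y - (1 - \<alpha>)) / E y) has_field_derivative
        ((1 - \<beta>) * deriv u y * E y - ((1 - \<beta>) * u y - (1 - \<alpha>)) * (- (1 + \<beta>) * deriv u y))
          / (E y * E y)) (at y)"
      by (rule derivative_eq_intros du[OF y] dE[OF y] E[OF y] refl)+ simp
    also have "(1 - \<beta>) * deriv u y * E y - ((1 - \<beta>) * u y - (1 - \<alpha>)) * (- (1 + \<beta>) * deriv u y)
        = \<delta> * deriv u y" by (simp add: E_def \<delta>_def algebra_simps)
    finally show "(p has_field_derivative \<delta> * deriv u y / (E y)\<^sup>2) (at y)"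
      by (simp add: p_def half_plane_transform_def E_def power2_eq_square)
  qed
  have p'': "deriv (deriv p) z
      = \<delta> * deriv (deriv u) z / (E z)\<^sup>2 + 2 * (1 + \<beta>) * \<delta> * (deriv u z)\<^sup>2 / (E z) ^ 3"
  proof (rule DERIV_imp_deriv)
    have "((\<lambda>y. \<delta> * deriv u y / (E y)\<^sup>2) has_field_derivative
        (\<delta> * deriv (deriv u) z * (E z)\<^sup>2
          - \<delta> * deriv u z * (2 * E z * (- (1 + \<beta>) * deriv u z))) / ((E z)\<^sup>2 * (E z)\<^sup>2)) (at z)"
      using E[OF S(2)]
      by (auto intro!: derivative_eq_intros du'[OF S(2)] dE[OF S(2)])
    also have "(\<delta> * deriv (deriv u) z * (E z)\<^sup>2
          - \<delta> * deriv u z * (2 * E z * (- (1 + \<beta>) * deriv u z))) / ((E z)\<^sup>2 * (E z)\<^sup>2)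
        = \<delta> * deriv (deriv u) z / (E z)\<^sup>2 + 2 * (1 + \<beta>) * \<delta> * (deriv u z)\<^sup>2 / (E z) ^ 3"
      using E[OF S(2)] by (simp add: divide_simps) (simp add: algebra_simps eval_nat_numeral)
    finally show "(deriv p has_field_derivative
        \<delta> * deriv (deriv u) z / (E z)\<^sup>2 + 2 * (1 + \<beta>) * \<delta> * (deriv u z)\<^sup>2 / (E z) ^ 3) (at z)"
      by (rule has_field_derivative_transform_within_open[OF _ S]) (simp add: p')
  qed
  have \<delta>: "\<delta> \<noteq> 0" using ab by (simp add: \<delta>_def)
  have pE: "p z * E z = (1 - \<beta>) * u z - (1 - \<alpha>)"
    using E[OF S(2)] by (simp add: p_def half_plane_transform_def E_def)
  have ED: "D * E z = \<delta>"
  proof -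
    have "D * E z = (1 - \<beta>) * E z + (1 + \<beta>) * (p z * E z)" by (simp add: D_def algebra_simps)
    then show ?thesis unfolding pE by (simp add: E_def \<delta>_def algebra_simps)
  qed
  have "N * E z = (1 - \<alpha>) * E z + (1 + \<alpha>) * (p z * E z)" by (simp add: N_def algebra_simps)
  also have "\<dots> = u z * (D * E z)" unfolding pE ED by (simp add: E_def \<delta>_def algebra_simps)
  finally have ND: "N = u z * D" using E[OF S(2)] by simp
  have D: "D \<noteq> 0" using ED \<delta> by auto
  have Ez: "E z = \<delta> / D" using ED D by (simp add: field_simps)
  have p'_D: "deriv p z = deriv u z * D\<^sup>2 / \<delta>"
    using p'[OF S(2)] \<delta> D by (simp add: Ez power2_eq_square)
  have p''_D: "deriv (deriv p) z
      = deriv (deriv u) z * D\<^sup>2 / \<delta> + 2 * (1 + \<beta>) * (deriv u z)\<^sup>2 * D ^ 3 / \<delta>\<^sup>2"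
    unfolding p'' Ez using \<delta> D by (simp add: power2_eq_square power3_eq_cube)
  have "z\<^sup>2 * deriv (deriv p) z - 2 * (1 + \<beta>) * (z * deriv p z)\<^sup>2 / D
      = z\<^sup>2 * deriv (deriv u) z * D\<^sup>2 / \<delta>"
    unfolding p'_D p''_D using \<delta> D
    by (simp add: divide_simps) (simp add: eval_nat_numeral algebra_simps)
  moreover have "c * z * (N * D) / (8 * (\<alpha> - \<beta>)) = z * (c / 4 * u z) * D\<^sup>2 / \<delta>"
    by (simp add: ND \<delta>_def power2_eq_square)
  ultimately have "z\<^sup>2 * deriv (deriv p) z - 2 * (1 + \<beta>) * (z * deriv p z)\<^sup>2 / D
           + \<kappa> * (z * deriv p z) + c * z * (N * D) / (8 * (\<alpha> - \<beta>))
      = z * D\<^sup>2 / \<delta> * (z * deriv (deriv u) z + \<kappa> * deriv u z + c / 4 * u z)"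
    unfolding p'_D using \<delta> by (simp add: power2_eq_square field_simps)
  then show ?thesis using ode by simp
qed

section \<open>The differential equation of the generalized Bessel function\<close>

text \<open>
  The recursion says that the coefficient of \<open>z\<^sup>n\<close> on the left-hand side of the equation vanishes.
\<close>
lemma power_series_solves_bessel_ode:
  fixes a :: "nat \<Rightarrow> complex" and \<kappa> c z :: complex
  assumes conv: "\<And>y. summable (\<lambda>n. a n * y ^ n)"
    and rec: "\<And>n. of_nat (Suc n) * (\<kappa> + of_nat n) * a (Suc n) = - (c / 4) * a n"
  defines "u \<equiv> (\<lambda>z. \<Sum>n. a n * z ^ n)"
  shows "u holomorphic_on UNIV"
    and "z * deriv (deriv u) z + \<kappa> * deriv u z + c / 4 * u z = 0"
proof -
  have du: "(u has_field_derivative (\<Sum>n. diffs a n * y ^ n)) (at y)" for y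
    unfolding u_def by (rule termdiffs_strong_converges_everywhere[OF conv])
  show "u holomorphic_on UNIV" using du by (auto simp: holomorphic_on_open)
  have u': "deriv u = (\<lambda>y. \<Sum>n. diffs a n * y ^ n)" using du by (intro ext DERIV_imp_deriv)
  have conv': "summable (\<lambda>n. diffs a n * y ^ n)" for y
    by (rule termdiff_converges_all[OF conv])
  have conv'': "summable (\<lambda>n. diffs (diffs a) n * y ^ n)" for y
    by (rule termdiff_converges_all[OF conv'])
  have u'': "deriv (deriv u) z = (\<Sum>n. diffs (diffs a) n * z ^ n)"
    unfolding u' by (intro DERIV_imp_deriv termdiffs_strong_converges_everywhere[OF conv'])
  have "(\<lambda>n. z * (of_nat n * diffs a n * z ^ (n - Suc 0))) sums (z * deriv (deriv u) z)"
    unfolding u'' by (intro sums_mult diffs_equiv conv'')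
  moreover have "z * (of_nat n * diffs a n * z ^ (n - Suc 0)) = of_nat n * diffs a n * z ^ n" for n
    by (cases n) (simp_all add: mult_ac)
  ultimately have s2: "(\<lambda>n. of_nat n * diffs a n * z ^ n) sums (z * deriv (deriv u) z)" by simp
  have s1: "(\<lambda>n. \<kappa> * (diffs a n * z ^ n)) sums (\<kappa> * deriv u z)"
    unfolding u' by (intro sums_mult summable_sums conv')
  have s0: "(\<lambda>n. c / 4 * (a n * z ^ n)) sums (c / 4 * u z)"
    unfolding u_def by (intro sums_mult summable_sums conv)
  have "of_nat n * diffs a n * z ^ n + \<kappa> * (diffs a n * z ^ n) + c / 4 * (a n * z ^ n) = 0" for n
  proof -
    have "of_nat n * diffs a n * z ^ n + \<kappa> * (diffs a n * z ^ n) + c / 4 * (a n * z ^ n)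
        = (of_nat (Suc n) * (\<kappa> + of_nat n) * a (Suc n) + c / 4 * a n) * z ^ n"
      by (simp add: diffs_def algebra_simps)
    then show ?thesis using rec[of n] by simp
  qed
  then have "(\<lambda>n. 0) sums (z * deriv (deriv u) z + \<kappa> * deriv u z + c / 4 * u z)"
    using sums_add[OF sums_add[OF s2 s1] s0] by simp
  then show "z * deriv (deriv u) z + \<kappa> * deriv u z + c / 4 * u z = 0"
    using sums_unique2 sums_zero by blast
qed

lemma gen_bessel_ode:
  assumes \<kappa>: "\<kappa> = lam + (b + 1) / 2" and nz: "\<forall>n::nat. \<kappa> \<noteq> - of_nat n"
  shows "gen_bessel lam b c holomorphic_on UNIV" (is ?hol)
    and "z * deriv (deriv (gen_bessel lam b c)) z + \<kappa> * deriv (gen_bessel lam b c) z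
           + c / 4 * gen_bessel lam b c z = 0" (is ?ode)
    and "gen_bessel lam b c 0 = 1" (is ?init)
proof -
  define a where "a n = ((-1) ^ n * c ^ n) / (4 ^ n * pochhammer \<kappa> n) / fact n" for n
  have poch: "pochhammer \<kappa> n \<noteq> 0" for n
    using nz by (auto simp: pochhammer_eq_0_iff)
  have nz': "\<kappa> + of_nat n \<noteq> 0" for n using nz by (metis eq_neg_iff_add_eq_0)
  have rec: "of_nat (Suc n) * (\<kappa> + of_nat n) * a (Suc n) = - (c / 4) * a n" for n
    using poch[of n] nz'[of n]
    by (simp add: a_def pochhammer_rec' divide_simps del: of_nat_Suc)
  have eq: "gen_bessel lam b c = (\<lambda>z. \<Sum>n. a n * z ^ n)"
    by (simp add: fun_eq_iff gen_bessel_def a_def \<kappa>)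
  have conv: "summable (\<lambda>n. a n * y ^ n)" for y
  proof -
    \<comment> \<open>From this index on, \<open>norm (\<kappa> + n)\<close> exceeds \<open>norm c * norm y\<close>, so consecutive terms shrink
      by the factor 1/2 at least.\<close>
    define m where "m = nat \<lceil>norm c * norm y + norm \<kappa> + 1\<rceil>"
    show ?thesis
    proof (rule summable_ratio_test[of "1/2" m])
      fix n assume "m \<le> n"
      then have n: "norm c * norm y + norm \<kappa> + 1 \<le> real n" unfolding m_def by linarith
      define q where "q = \<kappa> + of_nat n"
      have q: "q \<noteq> 0" using nz' by (simp add: q_def)
      have "real n \<le> norm q + norm \<kappa>"
        using norm_triangle_ineq4[of q \<kappa>] by (simp add: q_def)
      with n have k1: "norm c * norm y \<le> norm q" by linarith
      have "a (Suc n) = - (c / 4) * a n / (of_nat (Suc n) * q)"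
      proof (rule eq_divide_imp)
        show "of_nat (Suc n) * q \<noteq> 0" using q by (simp del: of_nat_Suc)
        show "a (Suc n) * (of_nat (Suc n) * q) = - (c / 4) * a n"
          using rec[of n] unfolding q_def by (simp only: mult_ac)
      qed
      then have "norm (a (Suc n) * y ^ Suc n)
          = (norm c * norm y) / (4 * real (Suc n) * norm q) * norm (a n * y ^ n)"
        by (simp add: norm_mult norm_divide norm_power mult_ac del: of_nat_Suc)
      also have "(norm c * norm y) / (4 * real (Suc n) * norm q) \<le> 1 / 2"
      proof -
        have "norm q * 2 \<le> norm q * (4 * real (Suc n))"
          by (intro mult_left_mono) auto
        then have "2 * (norm c * norm y) \<le> norm q * (4 * real (Suc n))" using k1 by linarith
        then show ?thesis using q by (simp add: pos_divide_le_eq mult_ac del: of_nat_Suc)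
      qed
      finally show "norm (a (Suc n) * y ^ Suc n) \<le> 1 / 2 * norm (a n * y ^ n)"
        by (simp add: mult_right_mono)
    qed simp
  qed
  show ?hol ?ode unfolding eq by (fact power_series_solves_bessel_ode[OF conv rec])+
  have "(\<Sum>n. a n * 0 ^ n) = a 0" by (rule powser_zero)
  then show ?init by (simp add: eq a_def)
qed

section \<open>The parameter conditions\<close>

text \<open>
  Here \<open>x = \<rho>\<^sup>2\<close> is the square of the imaginary part of \<open>p\<close> at the boundary point, and the two factors
  \<open>(1 - A)\<^sup>2 + (1 + A)\<^sup>2 x\<close> and \<open>(1 - B)\<^sup>2 + (1 + B)\<^sup>2 x\<close> are \<open>(norm N)\<^sup>2\<close> and \<open>(norm D)\<^sup>2\<close>, with \<open>N\<close> and
  \<open>D\<close> as in \<open>Moebius_transform_ode\<close>. The constant \<open>K\<close> separates the two sides of the comparison; it is the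
  coefficient of \<open>C\<close> in the condition that applies. The quotient \<open>(1 + x) / (norm D)\<^sup>2\<close> is monotone in
  \<open>x\<close>: its infimum is at \<open>x = 0\<close> for negative \<open>B\<close> and at infinity for \<open>B \<ge> 0\<close>, which produces
  the subtracted terms \<open>(1 + B) / (1 - B)\<close> and \<open>(1 - B) / (1 + B)\<close>. For \<open>B = - 1\<close> the factor
  \<open>1 - B\<^sup>2\<close> vanishes and only \<open>norm N / (1 + x)\<close> has to be bounded; its maximum over \<open>x \<ge> 0\<close> is at
  \<open>x = 0\<close> if \<open>A \<le> 3 - 2 sqrt 2\<close>, and at an interior point otherwise.
\<close>
lemma bessel_estimate:
  fixes A B k C :: real
  assumes "-1 \<le> B" "B < A" "A \<le> 1"
    and cond: "(B = -1 \<and> A \<le> 3 - 2 * sqrt 2 \<and>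
            k \<ge> C / (4 * (1 + A)) * (sqrt (2 * (1 + A\<^sup>2)) + (1 - A)))
       \<or> (B = -1 \<and> A > 3 - 2 * sqrt 2 \<and> k \<ge> C * (1 + A) / (8 * sqrt A))
       \<or> (-1 < B \<and> B < 0 \<and>
            k \<ge> C * (1 + A) * (1 - B)\<^sup>2 / (4 * (A - B) * (1 + B)) - (1 + B) / (1 - B))
       \<or> (B \<ge> 0 \<and> k \<ge> C * (1 + A) * (1 + B) / (4 * (A - B)) - (1 - B) / (1 + B))"
  obtains K where "0 < K"
    and "\<And>x. 0 \<le> x \<Longrightarrow>
      C * K \<le> k + (1 - B\<^sup>2) * (1 + x) / ((1 - B)\<^sup>2 + (1 + B)\<^sup>2 * x)"
    and "\<And>x. 0 \<le> x \<Longrightarrow>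
      ((1 - A)\<^sup>2 + (1 + A)\<^sup>2 * x) * ((1 - B)\<^sup>2 + (1 + B)\<^sup>2 * x)
        \<le> (4 * (A - B) * K * (1 + x))\<^sup>2"
proof -
  have A: "1 + A > 0" "1 - B > 0" using assms by auto
  consider (i) "B = -1" "A \<le> 3 - 2 * sqrt 2"
      "k \<ge> C / (4 * (1 + A)) * (sqrt (2 * (1 + A\<^sup>2)) + (1 - A))"
    | (ii) "B = -1" "A > 3 - 2 * sqrt 2" "k \<ge> C * (1 + A) / (8 * sqrt A)"
    | (iii) "-1 < B" "B < 0"
        "k \<ge> C * (1 + A) * (1 - B)\<^sup>2 / (4 * (A - B) * (1 + B)) - (1 + B) / (1 - B)"
    | (iv) "B \<ge> 0" "k \<ge> C * (1 + A) * (1 + B) / (4 * (A - B)) - (1 - B) / (1 + B)"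
    using cond by blast
  then show thesis
  proof cases
    case i
    define K where "K = (sqrt (2 * (1 + A\<^sup>2)) + (1 - A)) / (4 * (1 + A))"
    \<comment> \<open>Hence \<open>K\<close> is at least \<open>(1 - A) / (2 (1 + A))\<close>, which is what \<open>x = 0\<close> requires.\<close>
    have s: "1 - A \<le> sqrt (2 * (1 + A\<^sup>2))"
    proof (rule real_le_rsqrt)
      have "2 * (1 + A\<^sup>2) - (1 - A)\<^sup>2 = (1 + A)\<^sup>2" by (simp add: power2_eq_square algebra_simps)
      then show "(1 - A)\<^sup>2 \<le> 2 * (1 + A\<^sup>2)" by (smt (verit) zero_le_power2)
    qed
    have sp: "0 < sqrt (2 * (1 + A\<^sup>2))" by (simp add: add_pos_nonneg)
    have K: "0 < K" unfolding K_def using A sp assms by (intro divide_pos_pos add_pos_nonneg) auto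
    \<comment> \<open>The threshold \<open>3 - 2 sqrt 2\<close> is the smaller root of \<open>2 (1 - A)\<^sup>2 = (1 + A)\<^sup>2\<close>.\<close>
    have "(2 * sqrt 2)\<^sup>2 \<le> (3 - A)\<^sup>2" using i by (intro power_mono) auto
    then have q: "(1 + A)\<^sup>2 \<le> 2 * (1 - A)\<^sup>2"
      by (simp add: power2_eq_square algebra_simps)
    show thesis
    proof (rule that[OF K])
      fix x :: real assume x: "0 \<le> x"
      show "C * K \<le> k + (1 - B\<^sup>2) * (1 + x) / ((1 - B)\<^sup>2 + (1 + B)\<^sup>2 * x)"
        using i by (simp add: K_def)
      have "(1 + A)\<^sup>2 * x \<le> 2 * (1 - A)\<^sup>2 * x" using q x by (rule mult_right_mono)
      also have "\<dots> \<le> 2 * (1 - A)\<^sup>2 * x + (1 - A)\<^sup>2 * x\<^sup>2" by simp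
      finally have "(1 - A)\<^sup>2 + (1 + A)\<^sup>2 * x \<le> ((1 - A) * (1 + x))\<^sup>2"
        by (simp add: power2_eq_square algebra_simps)
      then have "((1 - A)\<^sup>2 + (1 + A)\<^sup>2 * x) * 4 \<le> (2 * (1 - A) * (1 + x))\<^sup>2"
        by (simp only: power_mult_distrib) simp
      also have "\<dots> \<le> (4 * (A - B) * K * (1 + x))\<^sup>2"
        using s A x i assms by (intro power_mono mult_right_mono) (auto simp: K_def add.commute)
      finally show "((1 - A)\<^sup>2 + (1 + A)\<^sup>2 * x) * ((1 - B)\<^sup>2 + (1 + B)\<^sup>2 * x)
        \<le> (4 * (A - B) * K * (1 + x))\<^sup>2" using i by simp
    qed
  next
    case ii
    have "2 * sqrt 2 = sqrt 8" using real_sqrt_mult[of 4 2] by simp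
    also have "sqrt 8 < 3" by (intro real_less_lsqrt) auto
    finally have Ap: "A > 0" using ii by linarith
    define K where "K = (1 + A) / (8 * sqrt A)"
    have K: "0 < K" unfolding K_def using A Ap by simp
    show thesis
    proof (rule that[OF K])
      fix x :: real assume x: "0 \<le> x"
      show "C * K \<le> k + (1 - B\<^sup>2) * (1 + x) / ((1 - B)\<^sup>2 + (1 + B)\<^sup>2 * x)"
        using ii by (simp add: K_def)
      define y where "y = (1 + A)\<^sup>2 * (1 + x)"
      \<comment> \<open>The maximum of \<open>norm N / (1 + x)\<close> is attained where \<open>y = 8 A\<close>.\<close>
      have "0 \<le> (y - 8 * A)\<^sup>2" by simp
      then have "16 * A * (y - 4 * A) \<le> y\<^sup>2"
        by (simp add: power2_eq_square algebra_simps)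
      moreover have "y - 4 * A = (1 - A)\<^sup>2 + (1 + A)\<^sup>2 * x"
        by (simp add: y_def power2_eq_square algebra_simps)
      moreover have "(4 * (A - B) * K * (1 + x))\<^sup>2 = y\<^sup>2 / (4 * A)"
        using Ap ii by (simp add: K_def y_def power_mult_distrib power_divide field_simps)
          (simp add: power2_eq_square algebra_simps)
      moreover have "(y - 4 * A) * 4 \<le> y\<^sup>2 / (4 * A)"
        using calculation(1) Ap by (simp add: pos_le_divide_eq mult_ac)
      ultimately show "((1 - A)\<^sup>2 + (1 + A)\<^sup>2 * x) * ((1 - B)\<^sup>2 + (1 + B)\<^sup>2 * x)
        \<le> (4 * (A - B) * K * (1 + x))\<^sup>2" using ii(1) by simp
    qed
  next
    case iii
    define K where "K = (1 + A) * (1 - B)\<^sup>2 / (4 * (A - B) * (1 + B))"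
    have K: "0 < K" unfolding K_def using A iii assms by simp
    show thesis
    proof (rule that[OF K])
      fix x :: real assume x: "0 \<le> x"
      define d where "d = (1 - B)\<^sup>2 + (1 + B)\<^sup>2 * x"
      have "(1 - B)\<^sup>2 > 0" using A by simp
      then have dp: "d > 0" unfolding d_def using x by (simp add: add_pos_nonneg)
      have "(1 + B)\<^sup>2 \<le> (1 - B)\<^sup>2" using iii by (intro power_mono) auto
      then have "(1 + B)\<^sup>2 * x \<le> (1 - B)\<^sup>2 * x" using x by (rule mult_right_mono)
      then have d: "d \<le> (1 - B)\<^sup>2 * (1 + x)" by (simp add: d_def algebra_simps)
      have "(1 + B) / (1 - B) = (1 + B) * d / ((1 - B) * d)" using dp by simp
      also have "\<dots> \<le> (1 + B) * ((1 - B)\<^sup>2 * (1 + x)) / ((1 - B) * d)"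
        using d dp A iii by (intro divide_right_mono mult_left_mono) auto
      also have "\<dots> = (1 - B\<^sup>2) * (1 + x) / d"
        using A dp by (simp add: field_simps) (simp add: power2_eq_square algebra_simps)
      finally show "C * K \<le> k + (1 - B\<^sup>2) * (1 + x) / ((1 - B)\<^sup>2 + (1 + B)\<^sup>2 * x)"
        using iii by (simp add: K_def d_def mult.assoc)
      \<comment> \<open>A common bound for \<open>1 - A\<close> and \<open>1 + A\<close>, which serves both signs of \<open>A\<close>.\<close>
      define m where "m = (1 + A) * (1 - B) / (1 + B)"
      have "(1 + A) * (1 + B) \<le> (1 + A) * (1 - B)"
        using A iii by (intro mult_left_mono) auto
      moreover have "(1 - A) * (1 + B) \<le> (1 + A) * (1 - B)"
        using assms by (simp add: algebra_simps)
      ultimately have AB: "1 - A \<le> m" "1 + A \<le> m"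
        using iii by (auto simp: m_def pos_le_divide_eq)
      have "(1 - A)\<^sup>2 \<le> m\<^sup>2" "(1 + A)\<^sup>2 \<le> m\<^sup>2" using AB A assms by (auto intro: power_mono)
      then have "(1 - A)\<^sup>2 + (1 + A)\<^sup>2 * x \<le> m\<^sup>2 + m\<^sup>2 * x"
        using x by (intro add_mono mult_right_mono) auto
      then have "((1 - A)\<^sup>2 + (1 + A)\<^sup>2 * x) * d \<le> (m\<^sup>2 * (1 + x)) * ((1 - B)\<^sup>2 * (1 + x))"
        using d dp x by (intro mult_mono) (auto simp: algebra_simps)
      also have "\<dots> = (m * (1 - B) * (1 + x))\<^sup>2"
        by (simp add: power2_eq_square mult_ac)
      also have "m * (1 - B) = 4 * (A - B) * K"
        using assms(2) iii(1) by (simp add: K_def m_def power2_eq_square)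
      finally show "((1 - A)\<^sup>2 + (1 + A)\<^sup>2 * x) * ((1 - B)\<^sup>2 + (1 + B)\<^sup>2 * x)
        \<le> (4 * (A - B) * K * (1 + x))\<^sup>2" by (simp add: d_def)
    qed
  next
    case iv
    define K where "K = (1 + A) * (1 + B) / (4 * (A - B))"
    have K: "0 < K" unfolding K_def using A iv assms by simp
    show thesis
    proof (rule that[OF K])
      fix x :: real assume x: "0 \<le> x"
      define d where "d = (1 - B)\<^sup>2 + (1 + B)\<^sup>2 * x"
      have "(1 - B)\<^sup>2 > 0" using A by simp
      then have dp: "d > 0" unfolding d_def using x by (simp add: add_pos_nonneg)
      have d: "d \<le> (1 + B)\<^sup>2 * (1 + x)"
        using power_mono[of "1 - B" "1 + B" 2] A iv by (simp add: d_def algebra_simps)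
      have ne: "(1 + B) * d \<noteq> 0" using iv(1) dp by simp
      have "(1 - B) / (1 + B) = (1 - B) * d / ((1 + B) * d)" using dp by simp
      also have "\<dots> \<le> (1 - B) * ((1 + B)\<^sup>2 * (1 + x)) / ((1 + B) * d)"
        using d dp A iv by (intro divide_right_mono mult_left_mono) auto
      also have "\<dots> = (1 - B\<^sup>2) * (1 + x) / d"
        using ne dp by (simp add: frac_eq_eq) (simp add: power2_eq_square algebra_simps)
      finally show "C * K \<le> k + (1 - B\<^sup>2) * (1 + x) / ((1 - B)\<^sup>2 + (1 + B)\<^sup>2 * x)"
        using iv by (simp add: K_def d_def mult.assoc)
      have "(1 - A)\<^sup>2 \<le> (1 + A)\<^sup>2" using iv assms by (intro power_mono) auto
      then have "(1 - A)\<^sup>2 + (1 + A)\<^sup>2 * x \<le> (1 + A)\<^sup>2 * (1 + x)" by (simp add: algebra_simps)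
      then have "((1 - A)\<^sup>2 + (1 + A)\<^sup>2 * x) * d \<le> ((1 + A)\<^sup>2 * (1 + x)) * ((1 + B)\<^sup>2 * (1 + x))"
        using d dp x by (intro mult_mono) auto
      also have "\<dots> = ((1 + A) * (1 + B) * (1 + x))\<^sup>2"
        by (simp add: power2_eq_square mult_ac)
      also have "(1 + A) * (1 + B) = 4 * (A - B) * K"
        using assms(2) by (simp add: K_def)
      finally show "((1 - A)\<^sup>2 + (1 + A)\<^sup>2 * x) * ((1 - B)\<^sup>2 + (1 + B)\<^sup>2 * x)
        \<le> (4 * (A - B) * K * (1 + x))\<^sup>2" by (simp add: d_def)
    qed
  qed
qed

section \<open>Positivity of the real part\<close>

text \<open>
  At a first boundary point \<open>\<zeta>\<close> put \<open>s = - \<zeta> p'\<close> and let \<open>W\<close> be the term of the transformed equation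
  that contains \<open>c\<close>. The equation forces \<open>Re W\<close> to be at least \<open>norm c * K * (1 + x) / 2\<close>, while
  \<open>norm \<zeta> < 1\<close> makes \<open>norm W\<close> strictly smaller. Strictness needs \<open>c \<noteq> 0\<close>.
\<close>
lemma Re_pos_of_bessel_ode:
  fixes A B K :: real and \<kappa> c :: complex and u :: "complex \<Rightarrow> complex"
  defines "p \<equiv> (\<lambda>z. half_plane_transform (of_real A) (of_real B) (u z))"
  assumes AB: "-1 \<le> B" "B < A" "A \<le> 1" and c: "c \<noteq> 0"
    and hol: "u holomorphic_on ball 0 1" and u0: "u 0 = 1"
    and ode: "\<And>z. norm z < 1 \<Longrightarrow> z * deriv (deriv u) z + \<kappa> * deriv u z + c / 4 * u z = 0"
    and ne: "\<forall>z\<in>ball 0 1. (1 + of_real B) * u z \<noteq> 1 + of_real A"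
    and K: "0 < K"
    and lower: "\<And>x. 0 \<le> x \<Longrightarrow>
      cmod c * K \<le> Re (\<kappa> - 1) + (1 - B\<^sup>2) * (1 + x) / ((1 - B)\<^sup>2 + (1 + B)\<^sup>2 * x)"
    and upper: "\<And>x. 0 \<le> x \<Longrightarrow>
      ((1 - A)\<^sup>2 + (1 + A)\<^sup>2 * x) * ((1 - B)\<^sup>2 + (1 + B)\<^sup>2 * x)
        \<le> (4 * (A - B) * K * (1 + x))\<^sup>2"
    and z: "norm z < 1"
  shows "0 < Re (p z)"
proof (rule ccontr)
  assume "\<not> 0 < Re (p z)"
  then have neg: "\<exists>z\<in>ball 0 1. Re (p z) \<le> 0"
    using z by (intro bexI[of _ z]) auto
  have p_hol: "p holomorphic_on ball 0 1"
    unfolding p_def half_plane_transform_def using ne hol by (intro holomorphic_intros) force+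
  have p0: "p 0 = 1" using AB by (simp add: p_def half_plane_transform_def u0)
  obtain \<zeta> where \<zeta>: "norm \<zeta> < 1" and re: "Re (p \<zeta>) = 0" and im: "Im (\<zeta> * deriv p \<zeta>) = 0"
    and s: "Re (\<zeta> * deriv p \<zeta>) \<le> - (1 + (Im (p \<zeta>))\<^sup>2) / 2"
    and t: "Re (\<zeta> * deriv p \<zeta>) + Re (\<zeta>\<^sup>2 * deriv (deriv p) \<zeta>) \<le> 0"
    using Miller_Mocanu_boundary_point[OF p_hol p0 neg] by blast
  define x where "x = (Im (p \<zeta>))\<^sup>2"
  define s where "s = - Re (\<zeta> * deriv p \<zeta>)"
  define d where "d = (1 - B)\<^sup>2 + (1 + B)\<^sup>2 * x"
  define N where "N = (1 - of_real A) + (1 + of_real A) * p \<zeta>"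
  define D where "D = (1 - of_real B) + (1 + of_real B) * p \<zeta>"
  have x: "0 \<le> x" by (simp add: x_def)
  have s_ge: "(1 + x) / 2 \<le> s" using s by (simp add: s_def x_def)
  have d_pos: "0 < d" unfolding d_def using AB x by (simp add: add_pos_nonneg)
  have zp': "\<zeta> * deriv p \<zeta> = - of_real s" using im by (simp add: s_def complex_eq_iff)
  have id: "\<zeta>\<^sup>2 * deriv (deriv p) \<zeta> - 2 * (1 + of_real B) * (\<zeta> * deriv p \<zeta>)\<^sup>2 / D
      + \<kappa> * (\<zeta> * deriv p \<zeta>) + c * \<zeta> * (N * D) / (8 * (of_real A - of_real B)) = 0"
    unfolding N_def D_def p_def
    using AB \<zeta> ne by (intro Moebius_transform_ode[of "ball 0 1"] hol ode) auto
  have ReD: "Re D = 1 - B" and ImD: "Im D = (1 + B) * Im (p \<zeta>)" using re by (auto simp: D_def)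
  have normD: "(cmod D)\<^sup>2 = d"
    unfolding cmod_power2 ReD ImD by (simp add: d_def x_def power_mult_distrib)
  have normN: "(cmod N)\<^sup>2 = (1 - A)\<^sup>2 + (1 + A)\<^sup>2 * x"
    unfolding cmod_power2 using re by (simp add: N_def x_def power_mult_distrib)
  \<comment> \<open>Since \<open>\<zeta> p'\<close> is real, only the real part of \<open>1 / D\<close> enters, and it is \<open>(1 - B) / d\<close>.\<close>
  have quot: "2 * (1 + of_real B) * (\<zeta> * deriv p \<zeta>)\<^sup>2 / D = of_real (2 * (1 + B) * s\<^sup>2) / D"
    unfolding zp' by simp
  have Re_quot: "Re (2 * (1 + of_real B) * (\<zeta> * deriv p \<zeta>)\<^sup>2 / D) = 2 * (1 - B\<^sup>2) * s\<^sup>2 / d"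
    unfolding quot Re_divide normD[unfolded cmod_power2]
    unfolding ReD
    by (simp add: power2_eq_square algebra_simps)
  define W where "W = c * \<zeta> * (N * D) / (8 * (of_real A - of_real B))"
  have "Re (\<zeta>\<^sup>2 * deriv (deriv p) \<zeta>) - 2 * (1 - B\<^sup>2) * s\<^sup>2 / d - Re \<kappa> * s + Re W = 0"
    using arg_cong[OF id, of Re] Re_quot by (simp add: W_def zp')
  moreover have "Re (\<zeta>\<^sup>2 * deriv (deriv p) \<zeta>) \<le> s" using t by (simp add: s_def)
  ultimately have "s * (Re (\<kappa> - 1) + 2 * (1 - B\<^sup>2) * s / d) \<le> Re W"
    by (simp add: algebra_simps power2_eq_square)
  moreover have "cmod c * K * ((1 + x) / 2) \<le> s * (Re (\<kappa> - 1) + 2 * (1 - B\<^sup>2) * s / d)"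
  proof -
    have B2: "0 \<le> 1 - B\<^sup>2" using AB by (simp add: abs_square_le_1)
    have "(1 - B\<^sup>2) * (1 + x) \<le> (1 - B\<^sup>2) * (2 * s)"
      using s_ge B2 by (intro mult_left_mono) auto
    then have "(1 - B\<^sup>2) * (1 + x) \<le> 2 * (1 - B\<^sup>2) * s"
      by (simp only: mult_ac)
    then have "(1 - B\<^sup>2) * (1 + x) / d \<le> 2 * (1 - B\<^sup>2) * s / d"
      using d_pos by (intro divide_right_mono) auto
    then have "cmod c * K \<le> Re (\<kappa> - 1) + 2 * (1 - B\<^sup>2) * s / d"
      using lower[OF x] by (simp add: d_def)
    then have "((1 + x) / 2) * (cmod c * K) \<le> s * (Re (\<kappa> - 1) + 2 * (1 - B\<^sup>2) * s / d)"
      using s_ge x K by (intro mult_mono) auto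
    then show ?thesis by (simp add: mult_ac)
  qed
  moreover have "Re W < cmod c * K * ((1 + x) / 2)"
  proof -
    have "(cmod N * cmod D)\<^sup>2 \<le> (4 * (A - B) * K * (1 + x))\<^sup>2"
      using upper[OF x] unfolding power_mult_distrib[of "cmod N"] normN normD d_def .
    then have ND: "cmod N * cmod D \<le> 4 * (A - B) * K * (1 + x)"
      by (rule power2_le_imp_le) (use AB K x in simp)
    have "cmod (8 * (of_real A - of_real B)) = 8 * (A - B)"
      using AB by (simp add: norm_mult flip: of_real_diff)
    then have "cmod W = cmod c * cmod \<zeta> * (cmod N * cmod D) / (8 * (A - B))"
      by (simp add: W_def norm_divide norm_mult)
    also have "\<dots> \<le> cmod c * cmod \<zeta> * (4 * (A - B) * K * (1 + x)) / (8 * (A - B))"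
      using ND AB by (intro divide_right_mono mult_left_mono) auto
    also have "\<dots> = cmod \<zeta> * (cmod c * K * ((1 + x) / 2))"
      using AB by (simp add: divide_simps) (simp add: algebra_simps)
    also have "\<dots> < 1 * (cmod c * K * ((1 + x) / 2))"
      using \<zeta> c K x by (intro mult_strict_right_mono) auto
    finally show ?thesis using complex_Re_le_cmod[of W] by simp
  qed
  ultimately show False by linarith
qed

theorem theorem2p1:
  fixes A B :: real and b c lam \<kappa> :: complex
  assumes "-1 \<le> B" and "B < A" and "A \<le> 1"
    and "\<kappa> = lam + (b + 1) / 2"
    and "\<forall>n::nat. \<kappa> \<noteq> - of_nat n"
    and "(B = -1 \<and> A \<le> 3 - 2 * sqrt 2 \<and>
            Re (\<kappa> - 1) \<ge> cmod c / (4 * (1 + A)) * (sqrt (2 * (1 + A\<^sup>2)) + (1 - A)))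
       \<or> (B = -1 \<and> A > 3 - 2 * sqrt 2 \<and>
            Re (\<kappa> - 1) \<ge> cmod c * (1 + A) / (8 * sqrt A) \<and>
            (A < 1 \<longrightarrow> Re (\<kappa> - 1) \<le> cmod c * (1 + A) / (2 * (1 - A))))
       \<or> (-1 < B \<and> B < 0 \<and>
            Re (\<kappa> - 1) \<ge> cmod c * (1 + A) * (1 - B)\<^sup>2 / (4 * (A - B) * (1 + B)) - (1 + B) / (1 - B))
       \<or> (B \<ge> 0 \<and>
            Re (\<kappa> - 1) \<ge> cmod c * (1 + A) * (1 + B) / (4 * (A - B)) - (1 - B) / (1 + B))"
    and "\<forall>z\<in>ball 0 1. (1 + of_real B) * gen_bessel lam b c z \<noteq> 1 + of_real A"
  shows "gen_bessel lam b c \<in> janowski A B"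
proof -
  note bessel = gen_bessel_ode[OF assms(4,5), where c = c]
  have hol: "gen_bessel lam b c holomorphic_on ball 0 1"
    using bessel(1) by (rule holomorphic_on_subset) simp
  show ?thesis
  proof (rule janowski_if_Re_pos[OF assms(2) hol bessel(3) assms(7)])
    fix z :: complex assume z: "norm z < 1"
    show "0 < Re (half_plane_transform (of_real A) (of_real B) (gen_bessel lam b c z))"
    proof (cases "c = 0")
      case True
      have "gen_bessel lam b c z = (\<Sum>k. (if k = 0 then 1 else 0) * z ^ k)"
        unfolding gen_bessel_def True by (intro suminf_cong) auto
      also have "\<dots> = 1" using sums_unique[OF powser_sums_if[of 0 z]] by simp
      finally have "gen_bessel lam b c z = 1" .
      then show ?thesis using assms(2) by (simp add: half_plane_transform_def)
    next
      case False
      obtain K where "0 < K"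
        and "\<And>x. 0 \<le> x \<Longrightarrow> cmod c * K
            \<le> Re (\<kappa> - 1) + (1 - B\<^sup>2) * (1 + x) / ((1 - B)\<^sup>2 + (1 + B)\<^sup>2 * x)"
        and "\<And>x. 0 \<le> x \<Longrightarrow>
          ((1 - A)\<^sup>2 + (1 + A)\<^sup>2 * x) * ((1 - B)\<^sup>2 + (1 + B)\<^sup>2 * x)
            \<le> (4 * (A - B) * K * (1 + x))\<^sup>2"
        using bessel_estimate[OF assms(1-3), where k = "Re (\<kappa> - 1)" and C = "cmod c"] assms(6)
        by blast
      from Re_pos_of_bessel_ode[OF assms(1-3) False hol bessel(3,2) assms(7) this z]
      show ?thesis .
    qed
  qed
qed

end
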